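(* Let $S$ be a set of $r$ primes. Then there exist at most $$\bigl(A(5,r)+A(2,r)^2\bigr)A(3,r)$$ $S$-Diophantine quadruples. If $r=2$ or $2\notin S$, then there exist at most $$A(5,r)A(3,r)$$ $S$-Diophantine quadruples.
   Context: Let $S$ be a fixed, finite set of primes. An $m$-tuple $(a_1,\dots,a_m)$ of positive, pairwise distinct integers is called $S$-Diophantine if for all $1\le i<j\le m$ the set of prime divisors of $a_ia_j+1$ is contained in $S$. An $S$-Diophantine quadruple is the case $m=4$. For a multiplicative subgroup $\Gamma$ of $\mathbb{Q}^*$ of rank $r$, $A(n,r)$ denotes an upper bound (depending only on $n$ and $r$) for the number of non-degenerate solutions $(x_1,\dots,x_n)\in\Gamma^n$ to the linear equation $a_1x_1+\dots+a_nx_n=1$ with coefficients $a_i\in\mathbb{Q}^*$. A solution is called non-degenerate if no subsum of the left-hand side $a_1x_1+\dots+a_nx_n$ vanishes. *)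

theory Defs
  imports Complex_Main "HOL-Algebra.Group" "HOL-Computational_Algebra.Primes"
begin

text \<open>Tuples are lists of the given length; in particular they are ordered.\<close>

definition S_Diophantine :: "nat set \<Rightarrow> nat \<Rightarrow> nat list \<Rightarrow> bool" where
  "S_Diophantine S m a \<longleftrightarrow>
     length a = m \<and> (\<forall>i<m. 0 < a ! i) \<and> distinct a \<and>
     (\<forall>i j. i < j \<and> j < m \<longrightarrow> prime_factors (a ! i * a ! j + 1) \<subseteq> S)"

definition Q_star :: "rat monoid" where
  "Q_star = \<lparr>carrier = UNIV - {0}, monoid.mult = (*), one = 1\<rparr>"

definition mult_independent :: "rat set \<Rightarrow> bool" where
  "mult_independent B \<longleftrightarrow>
     (\<forall>e :: rat \<Rightarrow> int. (\<Prod>b\<in>B. b powi e b) = 1 \<longrightarrow> (\<forall>b\<in>B. e b = 0))"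

text \<open>The rank is the largest size of a finite multiplicatively independent subset.
  Torsion does not contribute, so a group of rank \<open>r\<close> may or may not contain \<open>-1\<close>.\<close>

definition has_rank :: "rat set \<Rightarrow> nat \<Rightarrow> bool" where
  "has_rank \<Gamma> r \<longleftrightarrow>
     (\<exists>B\<subseteq>\<Gamma>. finite B \<and> mult_independent B \<and> card B = r) \<and>
     (\<forall>B\<subseteq>\<Gamma>. finite B \<and> mult_independent B \<longrightarrow> card B \<le> r)"

definition nondegenerate_solutions :: "rat set \<Rightarrow> nat \<Rightarrow> rat list \<Rightarrow> rat list set" where
  "nondegenerate_solutions \<Gamma> n c =
     {x. length x = n \<and> set x \<subseteq> \<Gamma> \<and> (\<Sum>i<n. c ! i * x ! i) = 1 \<and>
         (\<forall>I. I \<subseteq> {..<n} \<and> I \<noteq> {} \<longrightarrow> (\<Sum>i\<in>I. c ! i * x ! i) \<noteq> 0)}"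

text \<open>\<open>card\<close> vanishes on infinite sets, so finiteness is part of the bound.\<close>

definition unit_equation_bound :: "nat \<Rightarrow> nat \<Rightarrow> real \<Rightarrow> bool" where
  "unit_equation_bound n r N \<longleftrightarrow>
     (\<forall>\<Gamma> c. subgroup \<Gamma> Q_star \<and> has_rank \<Gamma> r \<and> length c = n \<and> set c \<subseteq> carrier Q_star \<longrightarrow>
        finite (nondegenerate_solutions \<Gamma> n c) \<and>
        real (card (nondegenerate_solutions \<Gamma> n c)) \<le> N)"

end

theory Submission imports Defs begin

text \<open>Write \<open>P, Q, M, N\<close> for the \<open>S\<close>-units \<open>ab+1, cd+1, ac+1, bd+1\<close>. From
  \<open>(P-1)(Q-1) = abcd = (M-1)(N-1)\<close> we get \<open>Q - Q/P - MN/P + M/P + N/P = 1\<close>, which is non-degenerate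
  unless \<open>P+Q\<close> is one of \<open>M, N\<close> or \<open>M+N\<close> is one of \<open>P, Q\<close>. By a coprimality argument this cannot also
  happen with \<open>ad+1, bc+1\<close> in place of \<open>M, N\<close>, so every quadruple gives a non-degenerate solution of
  one of the two five-term equations. Over the group of signed \<open>S\<close>-units both become
  \<open>x\<^sub>1 + \<dots> + x\<^sub>5 = 1\<close>, and a transposition of coordinates makes the sign patterns tell them
  apart, so a single \<open>A(5,r)\<close> accounts for both. Given such a solution, \<open>abcd\<close> is known and the remaining
  pair \<open>M', N'\<close> solves \<open>M' + N' - M'N' = 1 - abcd\<close>, which is never degenerate. This gives
  \<open>A(5,r) A(3,r)\<close> for every \<open>S\<close>.\<close>

section \<open>Integer relations between vectors\<close>

text \<open>Gaussian elimination on the coordinates in \<open>S\<close>, with cross-multiplication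
  in place of division so that all coefficients stay integral. Applied to exponent vectors, it
  bounds the rank of the group of signed \<open>S\<close>-units.\<close>

lemma integer_linear_dependence:
  fixes v :: "'a \<Rightarrow> 'b \<Rightarrow> int"
  assumes "finite S" and "finite B" and "card S < card B"
  shows "\<exists>e. (\<forall>p\<in>S. (\<Sum>b\<in>B. e b * v b p) = 0) \<and> (\<exists>b\<in>B. e b \<noteq> 0)"
  using assms
proof (induction S arbitrary: B v rule: finite_induct)
  case empty
  then have "B \<noteq> {}" by auto
  then show ?case by (intro exI[of _ "\<lambda>_. 1"]) auto
next
  case (insert p S)
  show ?case
  proof (cases "\<forall>b\<in>B. v b p = 0")
    case True
    have "card S < card B" using insert by simp
    then obtain e where "\<forall>p\<in>S. (\<Sum>b\<in>B. e b * v b p) = 0" "\<exists>b\<in>B. e b \<noteq> 0"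
      using insert.IH[OF insert.prems(1), of v] by blast
    with True show ?thesis by (intro exI[of _ e]) auto
  next
    case False
    then obtain b0 where b0: "b0 \<in> B" "v b0 p \<noteq> 0" by blast
    define C where "C = B - {b0}"
    have C: "finite C" "b0 \<notin> C" "B = insert b0 C" using insert b0 by (auto simp: C_def)
    have "card S < card C" using insert.prems(2) insert.hyps C by simp
    then obtain e where e: "\<forall>q\<in>S. (\<Sum>b\<in>C. e b * (v b0 p * v b q - v b p * v b0 q)) = 0"
        "\<exists>b\<in>C. e b \<noteq> 0"
      using insert.IH[OF C(1), of "\<lambda>b q. v b0 p * v b q - v b p * v b0 q"] by blast
    \<comment> \<open>The relation \<open>e\<close> among the eliminated vectors, rewritten for the
      original ones; the coefficient of the pivot \<open>b0\<close> collects its multiples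
      subtracted during elimination.\<close>
    define f where "f = (\<lambda>b. if b = b0 then - (\<Sum>b\<in>C. e b * v b p) else v b0 p * e b)"
    have sum_f: "(\<Sum>b\<in>B. f b * v b q)
        = (\<Sum>b\<in>C. e b * (v b0 p * v b q - v b p * v b0 q))" for q
    proof -
      have "(\<Sum>b\<in>C. f b * v b q) = (\<Sum>b\<in>C. v b0 p * e b * v b q)"
        using C(2) by (intro sum.cong) (auto simp: f_def)
      then show ?thesis using C(1,2)
        by (simp add: C(3) f_def sum_subtractf sum_distrib_left sum_distrib_right right_diff_distrib mult_ac)
    qed
    \<comment> \<open>At \<open>q = p\<close> every summand on the right of \<open>sum_f\<close>
      cancels; the other coordinates are covered by the choice of \<open>e\<close>.\<close>
    have "(\<Sum>b\<in>B. f b * v b q) = 0" if "q \<in> insert p S" for q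
      using that e(1) by (auto simp: sum_f)
    moreover have "\<exists>b\<in>B. f b \<noteq> 0" using e(2) b0 C by (auto simp: f_def)
    ultimately show ?thesis by blast
  qed
qed

section \<open>The group of signed S-units and its rank\<close>

text \<open>The sign is included so that negative terms of the equations lie in the group and all
  five coefficients can be 1. Being torsion, it leaves the rank at \<open>card S\<close>.\<close>

definition S_units :: "nat set \<Rightarrow> rat set" where
  "S_units S = {\<sigma> * (\<Prod>p\<in>S. of_nat p powi e p) | \<sigma> e. \<sigma> \<in> {1, -1}}"

lemma S_unitsI: "\<sigma> \<in> {1, -1} \<Longrightarrow> \<sigma> * (\<Prod>p\<in>S. of_nat p powi e p) \<in> S_units S"
  unfolding S_units_def by blast

lemma S_unitsE:
  assumes "x \<in> S_units S"
  obtains \<sigma> e where "\<sigma> \<in> {1, -1}" "x = \<sigma> * (\<Prod>p\<in>S. of_nat p powi e p)"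
  using assms unfolding S_units_def mem_Collect_eq by (elim exE conjE) (rule that)

lemma S_units_1 [simp]: "1 \<in> S_units S"
  using S_unitsI[of 1 "\<lambda>_. 0" S] by simp

lemma S_units_uminus [simp]: "- x \<in> S_units S" if "x \<in> S_units S"
proof -
  obtain \<sigma> e where x: "\<sigma> \<in> {1, -1}" "x = \<sigma> * (\<Prod>p\<in>S. of_nat p powi e p)"
    using \<open>x \<in> S_units S\<close> by (rule S_unitsE)
  have "- x = - \<sigma> * (\<Prod>p\<in>S. of_nat p powi e p)" unfolding x(2) by simp
  moreover have "- \<sigma> \<in> {1, -1}" using x(1) by auto
  ultimately show ?thesis by (simp only: S_unitsI)
qed

lemma S_units_inverse [simp]: "inverse x \<in> S_units S" if "x \<in> S_units S"
proof -
  obtain \<sigma> e where x: "\<sigma> \<in> {1, -1}" "x = \<sigma> * (\<Prod>p\<in>S. of_nat p powi e p)"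
    using \<open>x \<in> S_units S\<close> by (rule S_unitsE)
  have "inverse x = \<sigma> * (\<Prod>p\<in>S. inverse (of_nat p powi e p))"
    using x(1) unfolding x(2) prod_inversef[unfolded o_def] by auto
  also have "\<dots> = \<sigma> * (\<Prod>p\<in>S. of_nat p powi (- e p))"
    by (simp only: power_int_minus)
  finally have "inverse x = \<sigma> * (\<Prod>p\<in>S. of_nat p powi (- e p))" .
  then show ?thesis using x(1) by (simp only: S_unitsI)
qed

context
  fixes S :: "nat set"
  assumes fin: "finite S" and primes: "\<forall>p\<in>S. prime p"
begin

lemma S_nonzero: "p \<in> S \<Longrightarrow> p \<noteq> 0"
  using primes by (metis not_prime_0)

lemma S_units_mult [simp]: "x * y \<in> S_units S" if "x \<in> S_units S" "y \<in> S_units S"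
proof -
  obtain \<sigma> e where x: "\<sigma> \<in> {1, -1}" "x = \<sigma> * (\<Prod>p\<in>S. of_nat p powi e p)"
    using \<open>x \<in> S_units S\<close> by (rule S_unitsE)
  obtain \<tau> f where y: "\<tau> \<in> {1, -1}" "y = \<tau> * (\<Prod>p\<in>S. of_nat p powi f p)"
    using \<open>y \<in> S_units S\<close> by (rule S_unitsE)
  have "(\<Prod>p\<in>S. of_nat p powi (e p + f p))
      = (\<Prod>p\<in>S. of_nat p powi e p) * (\<Prod>p\<in>S. of_nat p powi f p :: rat)"
    unfolding prod.distrib[symmetric] using S_nonzero
    by (intro prod.cong refl) (simp add: power_int_add)
  then have "x * y = (\<sigma> * \<tau>) * (\<Prod>p\<in>S. of_nat p powi (e p + f p))"
    by (simp only: x(2) y(2) mult_ac)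
  moreover have "\<sigma> * \<tau> \<in> {1, -1}" using x(1) y(1) by auto
  ultimately show ?thesis by (simp only: S_unitsI)
qed

lemma S_units_divide [simp]: "x / y \<in> S_units S" if "x \<in> S_units S" "y \<in> S_units S"
  using that by (simp add: divide_inverse)

lemma S_units_nonzero: "x \<noteq> 0" if "x \<in> S_units S"
  using that S_nonzero[of 0] fin by (auto elim!: S_unitsE simp: power_int_eq_0_iff)

lemma of_nat_S_units: "of_nat n \<in> S_units S" if "0 < n" "prime_factors n \<subseteq> S"
proof -
  have "n = (\<Prod>p\<in>prime_factors n. p ^ multiplicity p n)"
    using that by (intro prime_factorization_nat)
  also have "\<dots> = (\<Prod>p\<in>S. p ^ multiplicity p n)"
    using that fin primes
    by (intro prod.mono_neutral_left)
       (auto simp: prime_factors_multiplicity)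
  finally have "(of_nat n :: rat) = (\<Prod>p\<in>S. of_nat p ^ multiplicity p n)"
    by (metis (mono_tags, lifting) of_nat_power of_nat_prod prod.cong)
  then show ?thesis using S_unitsI[of 1 "\<lambda>p. int (multiplicity p n)" S] by simp
qed

lemma group_Q_star: "group Q_star"
proof (rule groupI)
  show "\<exists>y\<in>carrier Q_star. y \<otimes>\<^bsub>Q_star\<^esub> x = \<one>\<^bsub>Q_star\<^esub>" if "x \<in> carrier Q_star" for x
    using that by (intro bexI[of _ "inverse x"]) (auto simp: Q_star_def)
qed (auto simp: Q_star_def)

lemma inv_Q_star: "inv\<^bsub>Q_star\<^esub> x = inverse x" if "x \<noteq> 0"
  using group.inv_equality[OF group_Q_star, of "inverse x" x] that by (auto simp: Q_star_def)

lemma subgroup_S_units: "subgroup (S_units S) Q_star"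
proof
  show "S_units S \<subseteq> carrier Q_star" using S_units_nonzero by (auto simp: Q_star_def)
  show "inv\<^bsub>Q_star\<^esub> x \<in> S_units S" if "x \<in> S_units S" for x
    using that S_units_nonzero by (simp add: inv_Q_star)
qed (auto simp: Q_star_def)

text \<open>Unique factorization: positive and negative exponents are moved to opposite sides, and
  multiplicities of the resulting naturals are compared.\<close>

lemma mult_independent_primes: "mult_independent (of_nat ` S)"
  unfolding mult_independent_def
proof (intro allI impI)
  fix e :: "rat \<Rightarrow> int"
  assume "(\<Prod>b\<in>of_nat ` S. b powi e b) = 1"
  then have one: "(\<Prod>p\<in>S. of_nat p powi e (of_nat p)) = (1 :: rat)"
    by (simp add: prod.reindex o_def)
  define f g where "f p = nat (e (of_nat p))" and "g p = nat (- e (of_nat p))" for p :: nat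
  have "of_nat p powi e (of_nat p) = (of_nat p ^ f p / of_nat p ^ g p :: rat)" for p :: nat
    by (auto simp: f_def g_def power_int_def divide_simps)
  then have "(\<Prod>p\<in>S. of_nat p ^ f p) / (\<Prod>p\<in>S. of_nat p ^ g p) = (1 :: rat)"
    using one by (simp add: prod_dividef)
  then have "(of_nat (\<Prod>p\<in>S. p ^ f p) :: rat) = of_nat (\<Prod>p\<in>S. p ^ g p)"
    by (simp add: divide_simps split: if_splits)
  then have eq: "(\<Prod>p\<in>S. p ^ f p) = (\<Prod>p\<in>S. p ^ g p)"
    by (simp only: of_nat_eq_iff)
  \<comment> \<open>At most one of \<open>f p\<close> and \<open>g p\<close> is positive, so their
    equality forces the exponent to be 0.\<close>
  have "f p = g p" if "p \<in> S" for p
    using arg_cong[OF eq, of "multiplicity p"] that fin primes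
    by (simp add: multiplicity_prod_prime_powers)
  then show "\<forall>b\<in>of_nat ` S. e b = 0" by (force simp: f_def g_def)
qed

lemma card_mult_independent_S_units:
  assumes B: "B \<subseteq> S_units S" "finite B" "mult_independent B"
  shows "card B \<le> card S"
proof (rule ccontr)
  assume "\<not> card B \<le> card S"
  have "\<forall>b\<in>B. \<exists>v. \<exists>\<sigma>\<in>{1, -1}. b = \<sigma> * (\<Prod>p\<in>S. of_nat p powi v p)"
  proof
    fix b assume "b \<in> B"
    with B(1) have "b \<in> S_units S" by blast
    then show "\<exists>v. \<exists>\<sigma>\<in>{1, -1}. b = \<sigma> * (\<Prod>p\<in>S. of_nat p powi v p)"
      by (rule S_unitsE) (intro exI bexI)
  qed
  from bchoice[OF this] obtain v where
    v: "\<forall>b\<in>B. \<exists>\<sigma>\<in>{1, -1}. b = \<sigma> * (\<Prod>p\<in>S. of_nat p powi v b p)" ..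
  obtain e where e: "\<forall>p\<in>S. (\<Sum>b\<in>B. e b * v b p) = 0" "\<exists>b\<in>B. e b \<noteq> 0"
    using integer_linear_dependence[of S B v] \<open>\<not> card B \<le> card S\<close> fin B(2) by auto
  have pw: "x powi (\<Sum>b\<in>B. h b) = (\<Prod>b\<in>B. x powi h b)" if "x \<noteq> 0" for x :: rat and h
    using B(2) by (induction B rule: finite_induct) (auto simp: power_int_add that)
  \<comment> \<open>Doubling the relation \<open>e\<close> turns the signs into even powers, so only
    the prime powers remain.\<close>
  have "b powi (2 * e b) = (\<Prod>p\<in>S. of_nat p powi (2 * (e b * v b p)))" if "b \<in> B" for b
  proof -
    obtain \<sigma> where \<sigma>: "\<sigma> \<in> {1, -1}" "b = \<sigma> * (\<Prod>p\<in>S. of_nat p powi v b p)"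
      by (rule bexE[OF bspec[OF v \<open>b \<in> B\<close>]])
    have "\<sigma> powi (2 * e b) = 1" using \<sigma>(1) by (auto simp: power_int_mult)
    then have "b powi (2 * e b) = (\<Prod>p\<in>S. of_nat p powi v b p) powi (2 * e b)"
      by (subst \<sigma>(2)) (simp add: power_int_mult_distrib)
    also have "\<dots> = (\<Prod>p\<in>S. (of_nat p powi v b p) powi (2 * e b))"
      using fin by (induction S rule: finite_induct) (auto simp: power_int_mult_distrib)
    finally show ?thesis by (simp add: power_int_mult[symmetric] mult_ac)
  qed
  then have "(\<Prod>b\<in>B. b powi (2 * e b)) = (\<Prod>p\<in>S. \<Prod>b\<in>B. of_nat p powi (2 * (e b * v b p)))"
    using prod.swap by (simp cong: prod.cong)
  also have "\<dots> = (\<Prod>p\<in>S. of_nat p powi (2 * (\<Sum>b\<in>B. e b * v b p)))"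
    using S_nonzero by (intro prod.cong refl) (simp add: pw sum_distrib_left)
  also have "\<dots> = 1" using e(1) by simp
  finally have "\<forall>b\<in>B. 2 * e b = 0"
    by (rule B(3)[unfolded mult_independent_def, rule_format, THEN ballI])
  with e(2) show False by auto
qed

lemma has_rank_S_units: "has_rank (S_units S) (card S)"
  unfolding has_rank_def
proof (intro conjI allI impI)
  have "of_nat p \<in> S_units S" if "p \<in> S" for p
    using that primes by (intro of_nat_S_units) (use prime_gt_0_nat in \<open>auto simp: prime_prime_factors\<close>)
  then show "\<exists>B\<subseteq>S_units S. finite B \<and> mult_independent B \<and> card B = card S"
    using fin mult_independent_primes
    by (intro exI[of _ "of_nat ` S"]) (auto simp: card_image)
qed (use card_mult_independent_S_units in blast)

end

lemma unit_equation_bound_S_units: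
  assumes "finite S" "\<forall>p\<in>S. prime p" "unit_equation_bound n (card S) N"
    and "length c = n" "0 \<notin> set c"
  shows "finite (nondegenerate_solutions (S_units S) n c)"
    and "real (card (nondegenerate_solutions (S_units S) n c)) \<le> N"
proof -
  have "set c \<subseteq> carrier Q_star" using assms(5) by (auto simp: Q_star_def)
  then show "finite (nondegenerate_solutions (S_units S) n c)"
    and "real (card (nondegenerate_solutions (S_units S) n c)) \<le> N"
    using assms subgroup_S_units has_rank_S_units unfolding unit_equation_bound_def by blast+
qed

section \<open>The five-term and three-term unit equations\<close>

definition degenerate :: "nat \<Rightarrow> nat \<Rightarrow> nat \<Rightarrow> nat \<Rightarrow> bool" where
  "degenerate p q m n \<longleftrightarrow> p + q = m \<or> p + q = n \<or> m + n = p \<or> m + n = q"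

text \<open>Here \<open>u\<close> and \<open>v\<close> stand for \<open>p * q\<close> and
  \<open>m * n\<close>, and the flags select the subsum. With exactly one of \<open>u\<close>,
  \<open>v\<close> present, the size conditions fix the sign. With both, \<open>eq\<close> replaces
  \<open>u - v\<close> by \<open>p + q - m - n\<close>, and what remains is excluded by
  \<open>uv\<close>, \<open>neq\<close>, \<open>nd\<close> or positivity; with neither, likewise by
  \<open>neq\<close>, \<open>nd\<close> or positivity.\<close>

lemma no_vanishing_subsum_int:
  fixes p q m n u v :: int
  assumes eq: "u + m + n = v + p + q"
    and gt: "p + q < u" "m + n < v" and uv: "u \<noteq> v" and pos: "0 < p" "0 < q" "0 < m" "0 < n"
    and neq: "p \<noteq> m" "p \<noteq> n" "q \<noteq> m" "q \<noteq> n"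
    and nd: "p + q \<noteq> m" "p + q \<noteq> n" "m + n \<noteq> p" "m + n \<noteq> q"
    and some: "b0 \<or> b1 \<or> b2 \<or> b3 \<or> b4"
  shows "of_bool b0 * u - of_bool b1 * q - of_bool b2 * v + of_bool b3 * m + of_bool b4 * n \<noteq> 0"
proof
  assume E: "of_bool b0 * u - of_bool b1 * q - of_bool b2 * v + of_bool b3 * m + of_bool b4 * n = 0"
  show False
    using some E eq gt pos
    by (cases b0; cases b1; cases b2; cases b3; cases b4; simp only: of_bool_eq simp_thms)
       (linarith | (rule notE[OF uv], linarith)
         | (rule notE[OF neq(1)], linarith) | (rule notE[OF neq(2)], linarith)
         | (rule notE[OF neq(3)], linarith) | (rule notE[OF neq(4)], linarith)
         | (rule notE[OF nd(1)], linarith) | (rule notE[OF nd(2)], linarith)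
         | (rule notE[OF nd(3)], linarith) | (rule notE[OF nd(4)], linarith))+
qed

lemma no_vanishing_subsum:
  fixes p q m n :: nat
  assumes eq: "p * q + m + n = m * n + p + q"
    and gt: "p + q < p * q" "m + n < m * n" and pos: "0 < p" "0 < q" "0 < m" "0 < n"
    and neq: "p \<noteq> m" "p \<noteq> n" "q \<noteq> m" "q \<noteq> n" and nd: "\<not> degenerate p q m n"
    and some: "b0 \<or> b1 \<or> b2 \<or> b3 \<or> b4"
  shows "of_bool b0 * of_nat q + of_bool b1 * (- of_nat q / of_nat p)
       + of_bool b2 * (- of_nat (m * n) / of_nat p)
       + of_bool b3 * (of_nat m / of_nat p) + of_bool b4 * (of_nat n / of_nat p) \<noteq> (0 :: rat)"
    (is "?L \<noteq> 0")
proof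
  assume "?L = 0"
  \<comment> \<open>Equal products would by \<open>eq\<close> also mean equal sums, so
    \<open>p\<close> would be a root of the quadratic with roots \<open>m\<close> and
    \<open>n\<close>.\<close>
  have "p * q \<noteq> m * n"
  proof
    assume "p * q = m * n"
    moreover from this have "p + q = m + n" using eq by simp
    ultimately have "(int p - int m) * (int p - int n) = 0"
      by (simp add: algebra_simps flip: of_nat_mult of_nat_add) (metis mult.commute add.commute distrib_left)
    with neq show False by simp
  qed
  define u v where "u = int (p * q)" and "v = int (m * n)"
  have "?L * of_nat p = of_int (of_bool b0 * u - of_bool b1 * int q - of_bool b2 * v
          + of_bool b3 * int m + of_bool b4 * int n)"
    using pos by (simp add: u_def v_def field_simps)
  with \<open>?L = 0\<close> have "of_bool b0 * u - of_bool b1 * int q - of_bool b2 * v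
          + of_bool b3 * int m + of_bool b4 * int n = 0"
    by (metis mult_zero_left of_int_eq_0_iff)
  moreover have "u + m + n = v + p + q" using eq unfolding u_def v_def by linarith
  moreover have "int p + q < u" "int m + n < v" "u \<noteq> v"
    using gt \<open>p * q \<noteq> m * n\<close> unfolding u_def v_def by linarith+
  moreover have "int p + int q \<noteq> m" "int p + int q \<noteq> n" "int m + int n \<noteq> p" "int m + int n \<noteq> q"
    using nd unfolding degenerate_def by linarith+
  ultimately show False
    using no_vanishing_subsum_int[of u m n v p q b0 b1 b2 b3 b4] pos neq some by simp
qed

text \<open>Turns a subsum over an arbitrary index set into a fixed number of flagged terms, the
  form in which nonvanishing is proved.\<close>

lemma sum_conv_of_bool: "(\<Sum>i\<in>I. f i) = (\<Sum>i<n. of_bool (i \<in> I) * f i)"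
  if "I \<subseteq> {..<n}" for f :: "nat \<Rightarrow> rat"
proof -
  have "(\<Sum>i<n. of_bool (i \<in> I) * f i) = (\<Sum>i\<in>{..<n} \<inter> I. f i)"
    by (auto simp: sum.inter_restrict intro!: sum.cong)
  with that show ?thesis by (simp add: Int_absorb1)
qed

text \<open>The equation is \<open>P * Q - Q - M * N + M + N = P\<close> divided by
  \<open>P\<close>. The second order of coordinates serves the degenerate branch of the code
  below.\<close>

lemma five_term_solution:
  fixes p q m n :: nat and \<Gamma> :: "rat set"
  assumes eq: "p * q + m + n = m * n + p + q"
    and gt: "p + q < p * q" "m + n < m * n" and pos: "0 < p" "0 < q" "0 < m" "0 < n"
    and neq: "p \<noteq> m" "p \<noteq> n" "q \<noteq> m" "q \<noteq> n" and nd: "\<not> degenerate p q m n"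
  defines "P \<equiv> of_nat p" and "Q \<equiv> of_nat q" and "M \<equiv> of_nat m" and "N \<equiv> of_nat n"
  assumes \<Gamma>: "Q \<in> \<Gamma>" "- Q / P \<in> \<Gamma>" "- (M * N) / P \<in> \<Gamma>" "M / P \<in> \<Gamma>" "N / P \<in> \<Gamma>"
  shows "[Q, - Q / P, - (M * N) / P, M / P, N / P]
           \<in> nondegenerate_solutions \<Gamma> 5 (replicate 5 1)" (is ?A)
    and "[- Q / P, Q, - (M * N) / P, M / P, N / P]
           \<in> nondegenerate_solutions \<Gamma> 5 (replicate 5 1)" (is ?B)
proof -
  have "(of_nat (p * q + m + n) :: rat) = of_nat (m * n + p + q)" using eq by simp
  then have rel: "P * Q + M + N = M * N + P + Q" by (simp add: P_def Q_def M_def N_def)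
  have "Q + - Q / P + - (M * N) / P + M / P + N / P = (P * Q - Q - M * N + M + N) / P"
    using pos by (simp add: P_def field_simps)
  also have "P * Q - Q - M * N + M + N = P" using rel by linarith
  finally have total: "Q + - Q / P + - (M * N) / P + M / P + N / P = 1"
    using pos by (simp add: P_def)
  have nv: "of_bool b0 * Q + of_bool b1 * (- Q / P) + of_bool b2 * (- (M * N) / P)
       + of_bool b3 * (M / P) + of_bool b4 * (N / P) \<noteq> 0"
    if "b0 \<or> b1 \<or> b2 \<or> b3 \<or> b4" for b0 b1 b2 b3 b4
    using no_vanishing_subsum[OF eq gt pos neq nd that] by (simp add: P_def Q_def M_def N_def)
  have ex: "0 \<in> I \<or> Suc 0 \<in> I \<or> 2 \<in> I \<or> 3 \<in> I \<or> 4 \<in> I" if "I \<subseteq> {..<5}" "I \<noteq> {}" for I :: "nat set"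
  proof -
    from that obtain i where "i \<in> I" "i < 5" by blast
    then have "i = 0 \<or> i = 1 \<or> i = 2 \<or> i = 3 \<or> i = 4" by linarith
    with \<open>i \<in> I\<close> show ?thesis by auto
  qed
  have five: "(\<Sum>i<5. f i) = f 0 + f (Suc 0) + f 2 + f 3 + f 4" for f :: "nat \<Rightarrow> rat"
    by (simp add: eval_nat_numeral)
  show ?A
    unfolding nondegenerate_solutions_def
  proof (intro CollectI conjI allI impI)
    show "(\<Sum>i<5. replicate 5 1 ! i * [Q, - Q / P, - (M * N) / P, M / P, N / P] ! i) = 1"
      using total by (simp add: five)
    fix I :: "nat set" assume I: "I \<subseteq> {..<5} \<and> I \<noteq> {}"
    have "(\<Sum>i\<in>I. replicate 5 1 ! i * [Q, - Q / P, - (M * N) / P, M / P, N / P] ! i)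
        = of_bool (0 \<in> I) * Q + of_bool (Suc 0 \<in> I) * (- Q / P) + of_bool (2 \<in> I) * (- (M * N) / P)
        + of_bool (3 \<in> I) * (M / P) + of_bool (4 \<in> I) * (N / P)"
      unfolding sum_conv_of_bool[OF conjunct1[OF I]] five by simp
    also have "\<dots> \<noteq> 0" using I ex by (intro nv) blast
    finally show "(\<Sum>i\<in>I. replicate 5 1 ! i * [Q, - Q / P, - (M * N) / P, M / P, N / P] ! i) \<noteq> 0" .
  qed (use \<Gamma> in auto)
  show ?B
    unfolding nondegenerate_solutions_def
  proof (intro CollectI conjI allI impI)
    show "(\<Sum>i<5. replicate 5 1 ! i * [- Q / P, Q, - (M * N) / P, M / P, N / P] ! i) = 1"
      using total by (simp add: five)
    fix I :: "nat set" assume I: "I \<subseteq> {..<5} \<and> I \<noteq> {}"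
    \<comment> \<open>Only the flags of the first two positions are exchanged, so \<open>nv\<close>
      still applies.\<close>
    have "(\<Sum>i\<in>I. replicate 5 1 ! i * [- Q / P, Q, - (M * N) / P, M / P, N / P] ! i)
        = of_bool (Suc 0 \<in> I) * Q + of_bool (0 \<in> I) * (- Q / P) + of_bool (2 \<in> I) * (- (M * N) / P)
        + of_bool (3 \<in> I) * (M / P) + of_bool (4 \<in> I) * (N / P)"
      unfolding sum_conv_of_bool[OF conjunct1[OF I]] five by simp
    also have "\<dots> \<noteq> 0" using I ex by (intro nv) blast
    finally show "(\<Sum>i\<in>I. replicate 5 1 ! i * [- Q / P, Q, - (M * N) / P, M / P, N / P] ! i) \<noteq> 0" .
  qed (use \<Gamma> in auto)
qed

text \<open>The coefficient normalizes \<open>M + N - M * N\<close>, which is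
  \<open>1 - (M - 1) * (N - 1)\<close>, to 1. The two-term subsums other than \<open>M + N\<close>
  factor as \<open>M * (1 - N)\<close> and \<open>N * (1 - M)\<close>, hence are nonzero.\<close>

lemma three_term_solution:
  fixes m n :: nat and \<Gamma> :: "rat set"
  assumes gt: "m + n < m * n"
  defines "M \<equiv> of_nat m" and "N \<equiv> of_nat n"
  assumes \<Gamma>: "M \<in> \<Gamma>" "N \<in> \<Gamma>" "- (M * N) \<in> \<Gamma>"
  shows "[M, N, - (M * N)] \<in> nondegenerate_solutions \<Gamma> 3 (replicate 3 (1 / (M + N - M * N)))"
proof -
  define K where "K = M + N - M * N"
  have "M + N < M * N" using gt unfolding M_def N_def
    by (metis of_nat_add of_nat_less_iff of_nat_mult)
  then have K: "K < 0" by (simp add: K_def)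
  have "m \<noteq> 0" "n \<noteq> 0" using gt by (auto intro: ccontr)
  moreover have "m \<noteq> 1" "n \<noteq> 1" using gt by (auto intro: ccontr)
  ultimately have pos: "M > 0" "N > 0" "M \<noteq> 1" "N \<noteq> 1" by (auto simp: M_def N_def)
  have three: "(\<Sum>i<3. f i) = f 0 + f (Suc 0) + f 2" for f :: "nat \<Rightarrow> rat"
    by (simp add: eval_nat_numeral)
  show ?thesis
    unfolding K_def[symmetric] nondegenerate_solutions_def
  proof (intro CollectI conjI allI impI)
    show "(\<Sum>i<3. replicate 3 (1 / K) ! i * [M, N, - (M * N)] ! i) = 1"
      using K by (simp add: three flip: diff_divide_distrib add_divide_distrib) (simp add: K_def)
    fix I :: "nat set" assume I: "I \<subseteq> {..<3} \<and> I \<noteq> {}"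
    then obtain i where "i \<in> I" "i < 3" by blast
    then have "0 \<in> I \<or> Suc 0 \<in> I \<or> 2 \<in> I"
      by (metis One_nat_def less_2_cases_iff less_antisym numeral_3_eq_3 numeral_2_eq_2)
    then have "of_bool (0 \<in> I) * M + of_bool (Suc 0 \<in> I) * N + of_bool (2 \<in> I) * (- (M * N)) \<noteq> 0"
      using pos K unfolding K_def
      by (cases "0 \<in> I"; cases "Suc 0 \<in> I"; cases "2 \<in> I") auto
    moreover have "(\<Sum>i\<in>I. replicate 3 (1 / K) ! i * [M, N, - (M * N)] ! i)
        = (of_bool (0 \<in> I) * M + of_bool (Suc 0 \<in> I) * N + of_bool (2 \<in> I) * (- (M * N))) / K"
      unfolding sum_conv_of_bool[OF conjunct1[OF I]] three
      by (simp add: add_divide_distrib diff_divide_distrib)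
    ultimately show "(\<Sum>i\<in>I. replicate 3 (1 / K) ! i * [M, N, - (M * N)] ! i) \<noteq> 0"
      using K by (simp only: divide_eq_0_iff) simp
  qed (use \<Gamma> in auto)
qed

section \<open>Impossibility of degeneracy for two pairings at once\<close>

text \<open>The equations make \<open>w\<close> divide \<open>x * z + 1\<close> and \<open>x * y + 1\<close>, hence \<open>y - z\<close>,
  and they force \<open>z < y < x < w\<close>.\<close>

lemma no_consecutive_degeneracy:
  fixes w x y z :: nat
  assumes 1: "w * x = w * y + x * z + 1" and 2: "w * y = w * z + y * x + 1"
  shows False
proof -
  have "w * y < w * x" "w * z < w * y" using 1 2 by simp_all
  then have "y < x" "z < y" by simp_all
  have "y * x < y * w" using 2 by (simp add: mult.commute)
  then have "x < w" by simp
  have "coprime w x"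
  proof (rule coprimeI)
    fix k assume "k dvd w" "k dvd x"
    then have "k dvd w * x" "k dvd w * y + x * z" by simp_all
    then show "is_unit k" using 1 dvd_add_right_iff by metis
  qed
  have "w * (x - y) = x * z + 1" "w * (y - z) = x * y + 1"
    using 1 2 by (simp_all add: diff_mult_distrib2 mult.commute)
  then have "w dvd x * z + 1" "w dvd x * y + 1" by (metis dvd_triv_left)+
  then have "w dvd (x * y + 1) - (x * z + 1)" by (rule dvd_diff_nat[rotated])
  then have "w dvd x * (y - z)" by (simp add: diff_mult_distrib2)
  with \<open>coprime w x\<close> have "w dvd y - z" by (simp add: coprime_dvd_mult_right_iff)
  with \<open>z < y\<close> have "w \<le> y - z" by (intro dvd_imp_le) auto
  with \<open>x < w\<close> \<open>y < x\<close> show False by simp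
qed

text \<open>Each hypothesis allows four equations, giving sixteen combinations. If
  \<open>a * b + c * d + 1\<close> is the large product in both, two products sharing a factor
  coincide. If it is in neither, there are equal sums or a cycle of inequalities. The eight mixed
  cases are instances of \<open>no_consecutive_degeneracy\<close>.\<close>

lemma not_both_degenerate:
  fixes a b c d :: nat
  assumes pos: "0 < a" "0 < b" "0 < c" "0 < d" and dist: "distinct [a, b, c, d]"
    and 1: "degenerate (a * b + 1) (c * d + 1) (a * c + 1) (b * d + 1)"
    and 2: "degenerate (a * b + 1) (c * d + 1) (a * d + 1) (b * c + 1)"
  shows False
proof -
  have mono: "x * y < x * z \<Longrightarrow> y < z" for x y z :: nat by simp
  have "(int a - int b) * (int c - int d) \<noteq> 0" using dist by simp
  then have "a * c + b * d \<noteq> a * d + b * c"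
    by (simp add: algebra_simps flip: of_nat_mult of_nat_add)
  moreover have "a * c \<noteq> a * d" "a * c \<noteq> b * c" "b * d \<noteq> a * d" "b * d \<noteq> b * c"
    using dist pos by auto
  \<comment> \<open>Cancelling common factors yields the cycle
    \<open>c < b < d < a < c\<close>.\<close>
  moreover have False if "a * b = a * c + b * d + 1" "c * d = a * d + b * c + 1"
  proof -
    have "a * c < a * b" "b * d < b * a" "d * a < d * c" "c * b < c * d"
      using that by (simp_all add: mult.commute)
    then show False by (auto dest!: mono)
  qed
  moreover have False if "c * d = a * c + b * d + 1" "a * b = a * d + b * c + 1"
  proof -
    have "c * a < c * d" "d * b < d * c" "a * d < a * b" "b * c < b * a"
      using that by (simp_all add: mult.commute)
    then show False by (auto dest!: mono)
  qed
  moreover note no_consecutive_degeneracy[of a c b d] no_consecutive_degeneracy[of a d b c]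
    no_consecutive_degeneracy[of b c a d] no_consecutive_degeneracy[of b d a c]
    no_consecutive_degeneracy[of c a d b] no_consecutive_degeneracy[of c b d a]
    no_consecutive_degeneracy[of d a c b] no_consecutive_degeneracy[of d b c a]
  ultimately show False using 1 2 pos unfolding degenerate_def
    by (smt (verit) mult.commute add.commute add.assoc add.left_commute add_right_cancel)
qed

section \<open>Recovering a quadruple from its products, and counting by fibres\<close>

text \<open>The products determine \<open>a\<close> because its square is
  \<open>(a * b) * (a * c) / (b * c)\<close>; dividing by \<open>a\<close> gives the rest.\<close>

lemma eq_of_products_eq:
  fixes a b c d a' b' c' d' :: nat
  assumes "0 < a" "0 < b" "0 < c" "0 < d"
    and ab: "a * b = a' * b'" and ac: "a * c = a' * c'" and bc: "b * c = b' * c'"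
    and ad: "a * d = a' * d'"
  shows "a = a' \<and> b = b' \<and> c = c' \<and> d = d'"
proof -
  have "a\<^sup>2 * (b * c) = (a * b) * (a * c)" by (simp add: power2_eq_square)
  also have "\<dots> = a'\<^sup>2 * (b * c)" unfolding ab ac bc by (simp add: power2_eq_square)
  finally have "a\<^sup>2 = a'\<^sup>2" using assms(2,3) by simp
  then have "a' = a" by simp
  with ab ac ad \<open>0 < a\<close> show ?thesis by simp
qed

lemma sum_less_mult: "p + q < p * q" if pq: "2 < p" "2 < q" for p q :: nat
proof -
  obtain i j where "p = 3 + i" "q = 3 + j"
    using le_Suc_ex[of 3 p] le_Suc_ex[of 3 q] pq by auto
  then show ?thesis by (simp add: algebra_simps)
qed

lemma two_less_Suc_prod: "2 < a * b + 1" if "0 < a" "0 < b" "a \<noteq> b" for a b :: nat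
proof -
  have "a * b \<noteq> 1" "a * b \<noteq> 0" using that by auto
  then show ?thesis by linarith
qed

lemma S_Diophantine_4E:
  assumes "S_Diophantine S 4 xs"
  obtains a b c d where "xs = [a, b, c, d]" "0 < a" "0 < b" "0 < c" "0 < d" "distinct [a, b, c, d]"
    "prime_factors (a * b + 1) \<subseteq> S" "prime_factors (a * c + 1) \<subseteq> S" "prime_factors (a * d + 1) \<subseteq> S"
    "prime_factors (b * c + 1) \<subseteq> S" "prime_factors (b * d + 1) \<subseteq> S" "prime_factors (c * d + 1) \<subseteq> S"
proof -
  have "length xs = 4" using assms by (simp add: S_Diophantine_def)
  then obtain a b c d where xs: "xs = [a, b, c, d]"
    by (auto simp: length_Suc_conv eval_nat_numeral)
  have pf: "i < j \<Longrightarrow> j < 4 \<Longrightarrow> prime_factors (xs ! i * xs ! j + 1) \<subseteq> S" for i j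
    using assms by (simp add: S_Diophantine_def)
  have "0 < xs ! i" if "i < 4" for i using that assms by (simp add: S_Diophantine_def)
  from this[of 0] this[of 1] this[of 2] this[of 3]
    pf[of 0 1] pf[of 0 2] pf[of 0 3] pf[of 1 2] pf[of 1 3] pf[of 2 3]
  show thesis using assms by (intro that[OF xs]) (simp_all add: xs S_Diophantine_def)
qed

lemma card_le_by_fibres:
  fixes N :: real
  assumes X: "finite X" "f ` D \<subseteq> X"
    and fibre: "\<And>x. x \<in> f ` D \<Longrightarrow> finite {a \<in> D. f a = x} \<and> real (card {a \<in> D. f a = x}) \<le> N"
    and "0 \<le> N"
  shows "finite D \<and> real (card D) \<le> real (card X) * N"
proof -
  have fin: "finite (f ` D)" using X finite_subset by blast
  have D: "D = (\<Union>x\<in>f ` D. {a \<in> D. f a = x})" by auto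
  have "card D \<le> (\<Sum>x\<in>f ` D. card {a \<in> D. f a = x})"
    by (subst D) (rule card_UN_le[OF fin])
  then have "real (card D) \<le> (\<Sum>x\<in>f ` D. real (card {a \<in> D. f a = x}))"
    by (simp flip: of_nat_sum)
  also have "\<dots> \<le> (\<Sum>x\<in>f ` D. N)"
    using fibre by (intro sum_mono) blast
  \<comment> \<open>Since \<open>N\<close> is nonnegative, the image may be enlarged to
    \<open>X\<close>.\<close>
  also have "\<dots> \<le> real (card X) * N"
    using card_mono[OF X] \<open>0 \<le> N\<close> by (simp add: mult_right_mono)
  finally have "real (card D) \<le> real (card X) * N" .
  moreover have "finite D"
    by (subst D) (rule finite_UN_I[OF fin], use fibre in blast)
  ultimately show ?thesis by blast
qed

section \<open>Encoding quadruples as solutions of unit equations\<close>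

text \<open>The positions of the first two entries record which of the two equations is used: their
  signs are \<open>+ -\<close> in the generic and \<open>- +\<close> in the degenerate case.\<close>

fun five_term_code :: "nat list \<Rightarrow> rat list" where
  "five_term_code [a, b, c, d] =
     (let P = of_nat (a * b + 1); Q = of_nat (c * d + 1) in
      if degenerate (a * b + 1) (c * d + 1) (a * c + 1) (b * d + 1)
      then let M = of_nat (a * d + 1); N = of_nat (b * c + 1)
           in [- Q / P, Q, - (M * N) / P, M / P, N / P]
      else let M = of_nat (a * c + 1); N = of_nat (b * d + 1)
           in [Q, - Q / P, - (M * N) / P, M / P, N / P])"
| "five_term_code _ = []"

text \<open>The branches use the pairing left out by \<open>five_term_code\<close>, so that the two
  codes together contain all six products.\<close>

fun three_term_code :: "nat list \<Rightarrow> rat list" where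
  "three_term_code [a, b, c, d] =
     (if degenerate (a * b + 1) (c * d + 1) (a * c + 1) (b * d + 1)
      then let M = of_nat (a * c + 1); N = of_nat (b * d + 1) in [M, N, - (M * N)]
      else let M = of_nat (a * d + 1); N = of_nat (b * c + 1) in [M, N, - (M * N)])"
| "three_term_code _ = []"

context
  fixes S :: "nat set"
  assumes fin: "finite S" and primes: "\<forall>p\<in>S. prime p"
begin

lemma five_term_code_solution:
  assumes "S_Diophantine S 4 xs"
  shows "five_term_code xs \<in> nondegenerate_solutions (S_units S) 5 (replicate 5 1)"
  using assms
proof (cases rule: S_Diophantine_4E)
  case (1 a b c d)
  note unit = of_nat_S_units[OF fin primes] S_units_divide[OF fin primes] S_units_mult[OF fin primes]
    S_units_uminus
  have gt: "2 < a * b + 1" "2 < a * c + 1" "2 < a * d + 1" "2 < b * c + 1" "2 < b * d + 1" "2 < c * d + 1"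
    by (rule two_less_Suc_prod; use 1 in simp)+
  show ?thesis
  proof (cases "degenerate (a * b + 1) (c * d + 1) (a * c + 1) (b * d + 1)")
    case True
    then have "\<not> degenerate (a * b + 1) (c * d + 1) (a * d + 1) (b * c + 1)"
      using not_both_degenerate 1 by blast
    then have "[- of_nat (c * d + 1) / of_nat (a * b + 1), of_nat (c * d + 1),
        - (of_nat (a * d + 1) * of_nat (b * c + 1)) / of_nat (a * b + 1),
        of_nat (a * d + 1) / of_nat (a * b + 1), of_nat (b * c + 1) / of_nat (a * b + 1)]
        \<in> nondegenerate_solutions (S_units S) 5 (replicate 5 1)"
      using 1 gt
      by (intro five_term_solution sum_less_mult unit) (auto simp: algebra_simps)
    then show ?thesis unfolding 1(1) five_term_code.simps Let_def if_P[OF True] .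
  next
    case False
    then have "[of_nat (c * d + 1), - of_nat (c * d + 1) / of_nat (a * b + 1),
        - (of_nat (a * c + 1) * of_nat (b * d + 1)) / of_nat (a * b + 1),
        of_nat (a * c + 1) / of_nat (a * b + 1), of_nat (b * d + 1) / of_nat (a * b + 1)]
        \<in> nondegenerate_solutions (S_units S) 5 (replicate 5 1)"
      using 1 gt
      by (intro five_term_solution sum_less_mult unit) (auto simp: algebra_simps)
    then show ?thesis unfolding 1(1) five_term_code.simps Let_def if_not_P[OF False] .
  qed
qed

text \<open>For either pairing \<open>(M - 1) * (N - 1)\<close> is the product of all four entries,
  so the equation depends on the quadruple only through that product.\<close>

lemma three_term_code_solution:
  assumes "S_Diophantine S 4 xs"
  shows "three_term_code xs
    \<in> nondegenerate_solutions (S_units S) 3 (replicate 3 (1 / (1 - of_nat (prod_list xs))))"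
  using assms
proof (cases rule: S_Diophantine_4E)
  case (1 a b c d)
  note unit = of_nat_S_units[OF fin primes] S_units_mult[OF fin primes] S_units_uminus
  have gt: "2 < a * c + 1" "2 < a * d + 1" "2 < b * c + 1" "2 < b * d + 1"
    by (rule two_less_Suc_prod; use 1 in simp)+
  have K: "of_nat (x + 1) + of_nat (y + 1) - of_nat (x + 1) * of_nat (y + 1)
      = (1 - of_nat (x * y) :: rat)" for x y
    by (simp add: algebra_simps)
  have xs: "prod_list xs = (a * c) * (b * d)" "prod_list xs = (a * d) * (b * c)"
    by (simp_all add: 1(1))
  have "[of_nat (a * c + 1), of_nat (b * d + 1), - (of_nat (a * c + 1) * of_nat (b * d + 1))]
    \<in> nondegenerate_solutions (S_units S) 3 (replicate 3 (1 / (1 - of_nat (prod_list xs))))"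
    unfolding xs(1) K[symmetric]
    using 1 gt by (intro three_term_solution sum_less_mult unit) auto
  moreover have "[of_nat (a * d + 1), of_nat (b * c + 1), - (of_nat (a * d + 1) * of_nat (b * c + 1))]
    \<in> nondegenerate_solutions (S_units S) 3 (replicate 3 (1 / (1 - of_nat (prod_list xs))))"
    unfolding xs(2) K[symmetric]
    using 1 gt by (intro three_term_solution sum_less_mult unit) auto
  ultimately show ?thesis
    unfolding 1(1) three_term_code.simps Let_def by (simp only: simp_thms split: if_split)
qed

lemma five_term_code_eqD:
  assumes eq: "five_term_code [a, b, c, d] = five_term_code [a', b', c', d']"
  shows "a * b = a' * b' \<and> c * d = c' * d' \<and>
    (if degenerate (a * b + 1) (c * d + 1) (a * c + 1) (b * d + 1)
     then degenerate (a' * b' + 1) (c' * d' + 1) (a' * c' + 1) (b' * d' + 1) \<and>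
       a * d = a' * d' \<and> b * c = b' * c'
     else \<not> degenerate (a' * b' + 1) (c' * d' + 1) (a' * c' + 1) (b' * d' + 1) \<and>
       a * c = a' * c' \<and> b * d = b' * d')"
proof -
  \<comment> \<open>After \<open>Q\<close>, the entry \<open>- Q / P\<close> gives \<open>P\<close>,
    and the last two entries give \<open>M\<close> and \<open>N\<close>.\<close>
  have code: "Q = Q' \<and> P = P' \<and> M = M' \<and> N = N'"
    if "0 < Q" "0 < P" "Q = Q'" "- Q / P = - Q' / P'" "M / P = M' / P'" "N / P = N' / P'"
    for P Q M N P' Q' M' N' :: rat
    \<comment> \<open>If \<open>P' = 0\<close>, then \<open>- Q' / P'\<close> is 0 by convention,
      while \<open>- Q / P\<close> is negative.\<close>
    using that by (cases "P' = 0") (auto simp: field_simps)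
  have pos: "0 < (of_nat (x + 1) :: rat)" for x by simp
  \<comment> \<open>Compares first coordinates of codes from different branches: one is positive,
    the other negative.\<close>
  have neg: "Q \<noteq> - Q' / P'" if "0 < P'" "0 < Q" "0 < Q'" for P' Q Q' :: rat
  proof -
    have "- Q' / P' < 0" using that by simp
    with \<open>0 < Q\<close> show ?thesis by (metis less_asym)
  qed
  have nat: "of_nat (x + 1) = (of_nat (y + 1) :: rat) \<longleftrightarrow> x = y" for x y
    by (simp del: of_nat_add)
  show ?thesis
  proof (cases "degenerate (a * b + 1) (c * d + 1) (a * c + 1) (b * d + 1)")
    case deg: True
    show ?thesis
    proof (cases "degenerate (a' * b' + 1) (c' * d' + 1) (a' * c' + 1) (b' * d' + 1)")
      case deg': True
      have "of_nat (c * d + 1) = (of_nat (c' * d' + 1) :: rat) \<and> of_nat (a * b + 1) = (of_nat (a' * b' + 1) :: rat)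
        \<and> of_nat (a * d + 1) = (of_nat (a' * d' + 1) :: rat) \<and> of_nat (b * c + 1) = (of_nat (b' * c' + 1) :: rat)"
        using eq[unfolded five_term_code.simps Let_def if_P[OF deg] if_P[OF deg'] list.inject]
        by (intro code[OF pos pos]) blast+
      with deg deg' show ?thesis by (simp only: nat if_True simp_thms)
    next
      case deg': False
      show ?thesis
        using eq[unfolded five_term_code.simps Let_def if_P[OF deg] if_not_P[OF deg'] list.inject]
          neg[OF pos pos pos] by metis
    qed
  next
    case deg: False
    show ?thesis
    proof (cases "degenerate (a' * b' + 1) (c' * d' + 1) (a' * c' + 1) (b' * d' + 1)")
      case deg': True
      show ?thesis
        using eq[unfolded five_term_code.simps Let_def if_not_P[OF deg] if_P[OF deg'] list.inject]
          neg[OF pos pos pos] by metis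
    next
      case deg': False
      have "of_nat (c * d + 1) = (of_nat (c' * d' + 1) :: rat) \<and> of_nat (a * b + 1) = (of_nat (a' * b' + 1) :: rat)
        \<and> of_nat (a * c + 1) = (of_nat (a' * c' + 1) :: rat) \<and> of_nat (b * d + 1) = (of_nat (b' * d' + 1) :: rat)"
        using eq[unfolded five_term_code.simps Let_def if_not_P[OF deg] if_not_P[OF deg'] list.inject]
        by (intro code[OF pos pos]) blast+
      with deg deg' show ?thesis by (simp only: nat if_False not_False_eq_True simp_thms)
    qed
  qed
qed

text \<open>Equal five-term codes give the same branch, the products \<open>a * b\<close> and
  \<open>c * d\<close>, and one further pairing; the three-term codes then supply the last
  pairing.\<close>

lemma codes_inject:
  assumes xs: "S_Diophantine S 4 xs" and ys: "S_Diophantine S 4 ys"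
    and five: "five_term_code xs = five_term_code ys"
    and three: "three_term_code xs = three_term_code ys"
  shows "xs = ys"
proof -
  obtain a b c d where a: "xs = [a, b, c, d]" "0 < a" "0 < b" "0 < c" "0 < d"
    using xs by (rule S_Diophantine_4E)
  obtain a' b' c' d' where a': "ys = [a', b', c', d']"
    using ys by (rule S_Diophantine_4E)
  note eqs = five_term_code_eqD[OF five[unfolded a(1) a']]
  have nat: "of_nat (x + 1) = (of_nat (y + 1) :: rat) \<longleftrightarrow> x = y" for x y
    by (simp del: of_nat_add)
  have "a * b = a' * b' \<and> a * c = a' * c' \<and> b * c = b' * c' \<and> a * d = a' * d'"
  proof (cases "degenerate (a * b + 1) (c * d + 1) (a * c + 1) (b * d + 1)")
    case True
    with eqs have deg: "degenerate (a' * b' + 1) (c' * d' + 1) (a' * c' + 1) (b' * d' + 1)"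
      by argo
    show ?thesis
      using eqs three[unfolded a(1) a' three_term_code.simps Let_def if_P[OF True] if_P[OF deg]] True
      by (simp only: list.inject nat if_True)
  next
    case False
    with eqs have deg: "\<not> degenerate (a' * b' + 1) (c' * d' + 1) (a' * c' + 1) (b' * d' + 1)"
      by argo
    show ?thesis
      using eqs three[unfolded a(1) a' three_term_code.simps Let_def if_not_P[OF False] if_not_P[OF deg]] False
      by (simp only: list.inject nat if_False)
  qed
  with eq_of_products_eq[OF a(2-5)] show ?thesis unfolding a(1) a' by blast
qed

text \<open>Ensures that all quadruples in a fibre of \<open>five_term_code\<close> lead to one and
  the same three-term equation.\<close>

lemma prod_list_eq_of_code_eq:
  assumes xs: "S_Diophantine S 4 xs" and ys: "S_Diophantine S 4 ys"
    and five: "five_term_code xs = five_term_code ys"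
  shows "prod_list xs = prod_list ys"
proof -
  obtain a b c d where a: "xs = [a, b, c, d]" using xs by (rule S_Diophantine_4E)
  obtain a' b' c' d' where a': "ys = [a', b', c', d']" using ys by (rule S_Diophantine_4E)
  have "a * b = a' * b'" "c * d = c' * d'"
    using five_term_code_eqD[OF five[unfolded a a']] by blast+
  then have "(a * b) * (c * d) = (a' * b') * (c' * d')" by simp
  then show ?thesis by (simp add: a a' mult.assoc)
qed

text \<open>\<open>five_term_code\<close> maps into a set of at most \<open>A5\<close> solutions,
  and \<open>three_term_code\<close> embeds each fibre into a set of at most
  \<open>A3\<close>.\<close>

lemma S_Diophantine_quadruples_bound:
  assumes A5: "unit_equation_bound 5 (card S) A5" and A3: "unit_equation_bound 3 (card S) A3"
  shows "finite {a. S_Diophantine S 4 a} \<and> real (card {a. S_Diophantine S 4 a}) \<le> A5 * A3"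
    and "0 \<le> A3"
proof -
  let ?D = "{a. S_Diophantine S 4 a}"
  let ?X = "nondegenerate_solutions (S_units S) 5 (replicate 5 1)"
  note bound5 = unit_equation_bound_S_units[OF fin primes A5, of "replicate 5 1"]
  \<comment> \<open>\<open>A3\<close> bounds a cardinality; the coefficients 1 are just a convenient
    nonzero choice.\<close>
  show "0 \<le> A3"
    using unit_equation_bound_S_units(2)[OF fin primes A3, of "replicate 3 1"] by simp
  have fibre: "finite {a \<in> ?D. five_term_code a = x}
      \<and> real (card {a \<in> ?D. five_term_code a = x}) \<le> A3"
    if "x \<in> five_term_code ` ?D" for x
  proof -
    let ?F = "{a \<in> ?D. five_term_code a = x}"
    from that obtain xs where xs: "S_Diophantine S 4 xs" "five_term_code xs = x" by blast
    let ?c = "replicate 3 (1 / (1 - of_nat (prod_list xs)) :: rat)"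
    let ?Y = "nondegenerate_solutions (S_units S) 3 ?c"
    \<comment> \<open>Otherwise the coefficient would be \<open>1 / 0\<close>, that is 0, and the
      bound would not apply.\<close>
    have "prod_list xs \<noteq> 1"
      using xs(1) by (cases rule: S_Diophantine_4E) simp
    then have "0 \<notin> set ?c" by simp
    note Y = unit_equation_bound_S_units[OF fin primes A3 _ this]
    have "three_term_code ` ?F \<subseteq> ?Y"
    proof (rule image_subsetI)
      fix ys assume ys: "ys \<in> ?F"
      then have "prod_list ys = prod_list xs" using xs by (intro prod_list_eq_of_code_eq) auto
      with ys show "three_term_code ys \<in> ?Y" using three_term_code_solution[of ys] by simp
    qed
    moreover have "inj_on three_term_code ?F"
      using codes_inject by (auto intro!: inj_onI)
    ultimately have "finite ?F" "card ?F \<le> card ?Y"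
      using Y(1) by (simp_all add: inj_on_finite card_inj_on_le)
    then show ?thesis using Y(2) by simp
  qed
  have "finite ?D \<and> real (card ?D) \<le> real (card ?X) * A3"
    using bound5(1) five_term_code_solution fibre \<open>0 \<le> A3\<close>
    by (intro card_le_by_fibres[of _ five_term_code]) auto
  moreover have "real (card ?X) * A3 \<le> A5 * A3"
    using bound5(2) \<open>0 \<le> A3\<close> by (simp add: mult_right_mono)
  ultimately show "finite ?D \<and> real (card ?D) \<le> A5 * A3" by simp
qed

end

theorem theorem1:
  fixes S :: "nat set" and r :: nat and A :: "nat \<Rightarrow> nat \<Rightarrow> real"
  assumes "finite S" and "card S = r" and "\<forall>p\<in>S. prime p"
    and "\<forall>n k. unit_equation_bound n k (A n k)"
  shows "finite {a. S_Diophantine S 4 a} \<and>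
         real (card {a. S_Diophantine S 4 a}) \<le> (A 5 r + (A 2 r)\<^sup>2) * A 3 r \<and>
         (r = 2 \<or> 2 \<notin> S \<longrightarrow> real (card {a. S_Diophantine S 4 a}) \<le> A 5 r * A 3 r)"
proof -
  note bound = S_Diophantine_quadruples_bound[OF assms(1,3), unfolded assms(2)]
  have "finite {a. S_Diophantine S 4 a} \<and> real (card {a. S_Diophantine S 4 a}) \<le> A 5 r * A 3 r"
    and "0 \<le> A 3 r"
    using bound assms(4) by blast+
  \<comment> \<open>The weaker estimate adds a square times the nonnegative \<open>A 3 r\<close> to
    the stronger one.\<close>
  moreover from this have "A 5 r * A 3 r \<le> (A 5 r + (A 2 r)\<^sup>2) * A 3 r"
    by (intro mult_right_mono) auto
  ultimately show ?thesis by linarith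
qed

end
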